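(* Let $s\ge\frac t2>0$ and $\zeta\in\Sigma_{s,t}\cap\mathbb U$. Then the measures $\nu_s$ and $k_{s,t}(\zeta,d\omega)$ on $\mathbb U$ are absolutely continuous with respect to each other with bounded densities; in particular, they have the same support.
   Context: $\mathbb U$, $\mathbb D$, $\mathbb C_\infty$: unit circle, open unit disk, Riemann sphere. For $r\in\mathbb R$ let $f_r(z)=z\exp\big(\frac r2\frac{1+z}{1-z}\big)$. For $s>0$, $\nu_s$ is the probability measure on $\mathbb U$ such that, with $\psi_s(z)=\int_{\mathbb U}\frac{\omega z}{1-\omega z}\nu_s(d\omega)$, the function $\chi_s=\psi_s/(1+\psi_s)$ satisfies $f_s(\chi_s(z))=z$ on $\mathbb D$. Known: with $\Omega_s=\{z\in\mathbb D:f_s(z)\in\mathbb D\}$, $f_s$ extends to a homeomorphism $\overline{\Omega_s}\to\overline{\mathbb D}$, conformal inside, with inverse $\chi_s:\overline{\mathbb D}\to\overline{\Omega_s}$, and $1\notin\overline{\Omega_s}$. Put $\chi_{s,t}=f_{s-t}\circ\chi_s$ on $\overline{\mathbb D}$ (injective for $s\ge\frac t2>0$, with values in $\overline{\mathbb D}$), $K=\chi_{s,t}(\overline{\mathbb D})$, and $\Sigma_{s,t}=\mathbb C_\infty\setminus(K\cup\{1/z:z\in K\})$. For $\zeta\in\mathbb U$, $k_{s,t}(\zeta,d\omega)$ is the unique probability measure on $\mathbb U$ with $\int_{\mathbb U}\frac{z\omega}{1-z\omega}k_{s,t}(\zeta,d\omega)=\frac{\chi_{s,t}(z)\zeta}{1-\chi_{s,t}(z)\zeta}$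 for all $z\in\mathbb D$. *)

theory Defs
  imports "HOL-Probability.Probability"
begin

definition f_exp :: "real \<Rightarrow> complex \<Rightarrow> complex" where
  "f_exp r z = z * exp (of_real r / 2 * ((1 + z) / (1 - z)))"

definition circle_borel :: "complex measure" where
  "circle_borel = restrict_space borel (sphere 0 1)"

definition prob_on_circle :: "complex measure \<Rightarrow> bool" where
  "prob_on_circle M \<longleftrightarrow> prob_space M \<and> sets M = sets circle_borel"

definition psi :: "complex measure \<Rightarrow> complex \<Rightarrow> complex" where
  "psi M z = (LINT \<omega>|M. \<omega> * z / (1 - \<omega> * z))"

text \<open>
  \<open>is_nu s \<nu>\<close> says that \<open>\<nu>\<close> is the measure \<open>\<nu>\<^sub>s\<close>: the quotient below is \<open>\<chi>\<^sub>s\<close> on the disk, and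
  since it vanishes at \<open>0\<close>, where \<open>f_exp s\<close> is locally injective, \<open>\<nu>\<close> is determined by this property.
\<close>

definition is_nu :: "real \<Rightarrow> complex measure \<Rightarrow> bool" where
  "is_nu s \<nu> \<longleftrightarrow> prob_on_circle \<nu> \<and>
     (\<forall>z \<in> ball 0 1. f_exp s (psi \<nu> z / (1 + psi \<nu> z)) = z)"

definition Omega :: "real \<Rightarrow> complex set" where
  "Omega s = {z \<in> ball 0 1. f_exp s z \<in> ball 0 1}"

text \<open>
  For \<open>s > 0\<close>, \<open>f_exp s\<close> is a homeomorphism from \<open>closure (Omega s)\<close> onto the closed disk, and the point
  \<open>1\<close> does not belong to \<open>closure (Omega s)\<close>. The function \<open>chi s\<close> is its inverse on the closed disk;
  on the open disk it is the function \<open>psi \<nu> / (1 + psi \<nu>)\<close> of \<^const>\<open>is_nu\<close>.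
\<close>

definition chi :: "real \<Rightarrow> complex \<Rightarrow> complex" where
  "chi s = inv_into (closure (Omega s)) (f_exp s)"

definition chi2 :: "real \<Rightarrow> real \<Rightarrow> complex \<Rightarrow> complex" where
  "chi2 s t z = f_exp (s - t) (chi s z)"

definition K_st :: "real \<Rightarrow> real \<Rightarrow> complex set" where
  "K_st s t = chi2 s t ` cball 0 1"

text \<open>
  On the Riemann sphere, \<open>\<Sigma>\<^sub>s\<^sub>,\<^sub>t\<close> is the complement of \<open>K\<close> and its reflection \<open>{1/z. z \<in> K}\<close>.
  As \<open>0 = chi2 s t 0 \<in> K_st s t\<close>, the point \<open>\<infinity> = 1/0\<close> is in the reflection, so \<open>\<Sigma>\<^sub>s\<^sub>,\<^sub>t\<close> is a
  subset of the plane, namely the following one.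
\<close>

definition Sigma_st :: "real \<Rightarrow> real \<Rightarrow> complex set" where
  "Sigma_st s t = - (K_st s t \<union> {1 / z | z. z \<in> K_st s t \<and> z \<noteq> 0})"

text \<open>\<open>is_k s t \<zeta> \<kappa>\<close> says that \<open>\<kappa>\<close> is the measure \<open>k\<^sub>s\<^sub>,\<^sub>t(\<zeta>, d\<omega>)\<close>.\<close>

definition is_k :: "real \<Rightarrow> real \<Rightarrow> complex \<Rightarrow> complex measure \<Rightarrow> bool" where
  "is_k s t \<zeta> \<kappa> \<longleftrightarrow> prob_on_circle \<kappa> \<and>
     (\<forall>z \<in> ball 0 1. (LINT \<omega>|\<kappa>. z * \<omega> / (1 - z * \<omega>))
        = chi2 s t z * \<zeta> / (1 - chi2 s t z * \<zeta>))"

text \<open>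
  Note the argument order of \<^const>\<open>absolutely_continuous\<close>: the second measure is absolutely
  continuous with respect to the first.
\<close>

definition ac_bounded_density :: "'a measure \<Rightarrow> 'a measure \<Rightarrow> bool" where
  "ac_bounded_density M N \<longleftrightarrow> absolutely_continuous M N \<and>
     (\<exists>g C. g \<in> borel_measurable M \<and> (\<forall>x \<in> space M. 0 \<le> g x \<and> g x \<le> (C::real)) \<and>
        N = density M (\<lambda>x. ennreal (g x)))"

definition measure_support :: "'a::topological_space measure \<Rightarrow> 'a set" where
  "measure_support M = {x \<in> space M. \<forall>U. open U \<and> x \<in> U \<longrightarrow> emeasure M (U \<inter> space M) > 0}"

end

theory Submission
  imports Defs "HOL-Complex_Analysis.Complex_Analysis" "HOL-Real_Asymp.Real_Asymp"
begin

text \<open>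
  If \<open>w = \<chi>\<^sub>s(z)\<close> and \<open>v = \<chi>\<^sub>s\<^sub>,\<^sub>t(z) \<zeta>\<close>, then the Poisson integrals of \<open>\<nu>\<^sub>s\<close> and \<open>k\<^sub>s\<^sub>,\<^sub>t(\<zeta>, d\<omega>)\<close> at \<open>z\<close> are
  \<open>(1 - |w|\<^sup>2) / |1 - w|\<^sup>2\<close> and \<open>(1 - |v|\<^sup>2) / |1 - v|\<^sup>2\<close>. Their quotient is bounded above and below: the
  denominators stay away from \<open>0\<close> by compactness of the closure of \<open>\<Omega>\<^sub>s\<close>, since \<open>1\<close> is not in it and
  \<open>\<zeta> \<in> \<Sigma>\<^sub>s\<^sub>,\<^sub>t\<close>; the numerators are comparable because \<open>|f\<^sub>s(w)| < 1\<close> and \<open>|v| = |f\<^sub>s\<^sub>-\<^sub>t(w)|\<close> force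
  \<open>|w|\<^sup>2 \<le> |v| \<le> |w|\<^sup>c\<close> with \<open>c = min 1 (t / s)\<close>. By Poisson's formula an inequality between
  Poisson integrals passes to the measures, and Radon--Nikodym gives bounded densities.
\<close>

section \<open>The map \<open>f\<^sub>s\<close> on the closure of \<open>\<Omega>\<^sub>s\<close>\<close>

text \<open>The right-hand side is the Poisson kernel for the boundary point 1. It governs both the
  modulus of \<open>f_exp\<close> and the Poisson integrals below.\<close>

lemma Re_cayley: "Re ((1 + z) / (1 - z)) = (1 - (cmod z)\<^sup>2) / (cmod (1 - z))\<^sup>2"
  by (simp add: Re_divide cmod_power2) (simp add: algebra_simps power2_eq_square)

lemma norm_f_exp:
  "cmod (f_exp r z) = cmod z * exp (r / 2 * ((1 - (cmod z)\<^sup>2) / (cmod (1 - z))\<^sup>2))"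
proof -
  have "Re (of_real r / 2 * ((1 + z) / (1 - z))) = r / 2 * Re ((1 + z) / (1 - z))"
    using complex.sel scaleR_complex.sel(1)[of "r / 2" "(1 + z) / (1 - z)"] by (simp add: scaleR_conv_of_real)
  then show ?thesis
    by (simp add: f_exp_def norm_mult norm_exp_eq_Re Re_cayley)
qed

lemma f_exp_0 [simp]: "f_exp r 0 = 0"
  by (simp add: f_exp_def)

lemma f_exp_eq_0_iff [simp]: "f_exp r z = 0 \<longleftrightarrow> z = 0"
  by (simp add: f_exp_def)

lemma holomorphic_f_exp: "f_exp r holomorphic_on (- {1})"
  unfolding f_exp_def by (intro holomorphic_intros) auto

lemma continuous_on_f_exp: "1 \<notin> S \<Longrightarrow> continuous_on S (f_exp r)"
  by (rule holomorphic_on_imp_continuous_on, rule holomorphic_on_subset[OF holomorphic_f_exp]) auto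

text \<open>Combining \<open>\<bar>f_exp s w\<bar> < 1\<close> with
  \<open>exp x \<ge> 1 + x\<close>, a factor \<open>1 - cmod w\<close> cancels. What remains is a
  closed condition that fails at 1, where it would read \<open>2 * s \<le> 0\<close>; hence 1 is not
  even a limit point of \<open>Omega s\<close>.\<close>

lemma Omega_bound:
  assumes "s > 0" "w \<in> Omega s"
  shows "s * cmod w * (1 + cmod w) \<le> 2 * (cmod (1 - w))\<^sup>2"
proof (cases "w = 0")
  case False
  let ?p = "cmod w" and ?d = "(cmod (1 - w))\<^sup>2"
  have p: "0 < ?p" "?p < 1" using assms False by (auto simp: Omega_def)
  then have d: "?d > 0" by auto
  define P where "P = (1 - ?p\<^sup>2) / ?d"
  have "?p * exp (s / 2 * P) < 1"
    using assms(2) by (simp add: Omega_def norm_f_exp P_def)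
  then have "exp (s / 2 * P) < 1 / ?p" using p by (simp add: field_simps)
  then have "1 + s / 2 * P < 1 / ?p"
    using exp_ge_add_one_self[of "s / 2 * P"] by linarith
  then have "s * (?p * P) \<le> 2 * (1 - ?p)" using p by (simp add: field_simps)
  then have "s * ?p * (P * ?d) \<le> 2 * (1 - ?p) * ?d"
    using mult_right_mono[of "s * (?p * P)" "2 * (1 - ?p)" ?d] by (simp add: mult_ac)
  moreover have "P * ?d = (1 - ?p) * (1 + ?p)"
  proof -
    have "P * ?d = 1 - ?p\<^sup>2" using d by (simp add: P_def)
    then show ?thesis by (simp add: power2_eq_square algebra_simps)
  qed
  ultimately have "(1 - ?p) * (s * ?p * (1 + ?p)) \<le> (1 - ?p) * (2 * ?d)"
    by (simp only: mult_ac)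
  then show ?thesis using p by simp
qed simp

lemma one_notin_closure_Omega:
  assumes "s > 0"
  shows "1 \<notin> closure (Omega s)"
proof -
  have "closed {w. s * cmod w * (1 + cmod w) \<le> 2 * (cmod (1 - w))\<^sup>2}"
    by (intro closed_Collect_le continuous_intros)
  then have "closure (Omega s) \<subseteq> {w. s * cmod w * (1 + cmod w) \<le> 2 * (cmod (1 - w))\<^sup>2}"
    by (rule closure_minimal[rotated]) (use Omega_bound[OF assms] in blast)
  with assms show ?thesis by fastforce
qed

lemma compact_closure_Omega: "compact (closure (Omega s))"
  by (simp add: compact_closure) (metis (no_types, lifting) Omega_def bounded_ball bounded_subset mem_Collect_eq subsetI)

lemma norm_le_1_closure_Omega:
  assumes "w \<in> closure (Omega s)"
  shows "cmod w \<le> 1"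
proof -
  have "closure (Omega s) \<subseteq> cball 0 1"
    by (rule closure_minimal) (auto simp: Omega_def)
  with assms show ?thesis by auto
qed

lemma open_Omega: "open (Omega s)"
proof -
  have "Omega s = ball 0 1 \<inter> f_exp s -` ball 0 1" by (auto simp: Omega_def)
  then show ?thesis
    using continuous_open_preimage[OF continuous_on_f_exp[of "ball 0 1" s], of "ball 0 1"] by auto
qed

lemma f_exp_closure_Omega:
  assumes "s > 0" "w \<in> closure (Omega s)"
  shows "cmod (f_exp s w) \<le> 1"
proof -
  have "f_exp s ` closure (Omega s) \<subseteq> cball 0 1"
    by (rule image_closure_subset)
       (use continuous_on_f_exp[OF one_notin_closure_Omega[OF assms(1)]] in \<open>auto simp: Omega_def\<close>)
  with assms show ?thesis by auto
qed

text \<open>On the unit circle the exponent in \<open>norm_f_exp\<close> vanishes, so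
  \<open>f_exp s\<close> has modulus 1 there; a value of modulus below 1 therefore forces
  \<open>w\<close> into the open disk.\<close>

lemma closure_Omega_inside:
  assumes "s > 0" "w \<in> closure (Omega s)" "cmod (f_exp s w) < 1"
  shows "w \<in> Omega s"
proof -
  have "cmod w \<noteq> 1" using assms(3) by (auto simp: norm_f_exp)
  then show ?thesis
    using assms norm_le_1_closure_Omega[OF assms(2)] by (auto simp: Omega_def)
qed

text \<open>The part of \<open>\<Omega>\<^sub>s\<close> missed by a right inverse \<open>G\<close> of \<open>f_exp s\<close> is open, \<open>f_exp s\<close> has no zero
  there and has modulus \<open>1\<close> on its frontier, so the maximum principle for \<open>1 / f_exp s\<close> shows that
  it is empty.\<close>

lemma right_inverse_onto_Omega:
  assumes s: "s > 0" and cont: "continuous_on (ball 0 1) G"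
    and G: "\<And>z. z \<in> ball 0 1 \<Longrightarrow> G z \<in> Omega s"
    and fG: "\<And>z. z \<in> ball 0 1 \<Longrightarrow> f_exp s (G z) = z"
    and w: "w \<in> Omega s"
  shows "G (f_exp s w) = w"
proof -
  define V where "V = {w \<in> Omega s. G (f_exp s w) \<noteq> w}"
  \<comment> \<open>\<open>G\<close> is only assumed continuous, so its image is open by invariance
    of domain.\<close>
  have "inj_on G (ball 0 1)" using fG by (metis inj_on_inverseI)
  then have "open (G ` ball 0 1)"
    using invariance_of_domain[OF cont] by simp
  have fOm: "f_exp s w \<in> ball 0 1" if "w \<in> Omega s" for w using that by (simp add: Omega_def)
  have im: "G ` ball 0 1 = {w \<in> Omega s. G (f_exp s w) = w}"
  proof (intro set_eqI iffI)
    fix w assume "w \<in> {w \<in> Omega s. G (f_exp s w) = w}"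
    then show "w \<in> G ` ball 0 1" using fOm by (metis (mono_tags, lifting) imageI mem_Collect_eq)
  qed (use G fG in auto)
  have contf: "continuous_on (Omega s) (f_exp s)"
    by (rule continuous_on_f_exp) (auto simp: Omega_def)
  have contGf: "continuous_on (Omega s) (\<lambda>w. G (f_exp s w) - w)"
    by (intro continuous_intros continuous_on_compose2[OF cont contf]) (use fOm in auto)
  have Vpre: "V = Omega s \<inter> (\<lambda>w. G (f_exp s w) - w) -` (- {0})" by (auto simp: V_def)
  have openV: "open V"
    unfolding Vpre by (rule continuous_open_preimage[OF contGf open_Omega]) auto
  have clV: "closure V \<subseteq> closure (Omega s)" by (rule closure_mono) (auto simp: V_def)
  have "0 \<in> G ` ball 0 1" using fG[of 0] by (metis centre_in_ball f_exp_eq_0_iff image_eqI zero_less_one)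
  moreover have "closure V \<inter> G ` ball 0 1 = {}"
    using \<open>open (G ` ball 0 1)\<close> im by (subst Int_commute, subst open_Int_closure_eq_empty) (auto simp: V_def)
  \<comment> \<open>The open image of \<open>G\<close> is the complement of \<open>V\<close> in
    \<open>Omega s\<close>, so \<open>V\<close> is relatively closed in \<open>Omega s\<close> and
    its frontier lies outside \<open>Omega s\<close>. The point 0 is in the image, which keeps the
    zero of \<open>f_exp s\<close> away from \<open>closure V\<close>.\<close>
  ultimately have V0: "0 \<notin> closure V" and Vdisj: "closure V \<inter> Omega s = V"
    using im closure_subset[of V] by (auto simp: V_def)
  have one: "1 \<notin> closure V" using one_notin_closure_Omega[OF s] clV by auto
  have hol: "(\<lambda>z. 1 / f_exp s z) holomorphic_on (- {0, 1})"
    by (intro holomorphic_intros holomorphic_on_subset[OF holomorphic_f_exp]) auto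
  have bounded: "bounded V"
    by (rule bounded_subset[of "ball 0 1"]) (auto simp: V_def Omega_def)
  have "V = {}"
  proof (rule ccontr)
    assume "V \<noteq> {}"
    then obtain v where v: "v \<in> V" by auto
    have "cmod (1 / f_exp s v) \<le> 1"
    proof (rule maximum_modulus_frontier[of "\<lambda>z. 1 / f_exp s z" V])
      show "(\<lambda>z. 1 / f_exp s z) holomorphic_on interior V"
        by (rule holomorphic_on_subset[OF hol])
           (use V0 one closure_subset[of V] interior_subset[of V] in auto)
      show "continuous_on (closure V) (\<lambda>z. 1 / f_exp s z)"
        by (rule holomorphic_on_imp_continuous_on, rule holomorphic_on_subset[OF hol])
           (use V0 one in auto)
      fix z assume "z \<in> frontier V"
      then have z: "z \<in> closure V" "z \<notin> V" using openV by (auto simp: frontier_def interior_open)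
      then have "z \<notin> Omega s" using Vdisj by auto
      then have "\<not> cmod (f_exp s z) < 1" using closure_Omega_inside[OF s] z clV by blast
      then show "cmod (1 / f_exp s z) \<le> 1" by (simp add: norm_divide divide_simps)
    qed (use v bounded in auto)
    moreover have "0 < cmod (f_exp s v)" "cmod (f_exp s v) < 1"
      using v V0 closure_subset[of V] fOm[of v] by (auto simp: V_def)
    ultimately show False by (simp add: norm_divide)
  qed
  with w show ?thesis by (auto simp: V_def)
qed

text \<open>Over a small disk around \<open>f_exp s a\<close>, the connected set of values of \<open>G\<close> cannot cross a small
  circle around \<open>a\<close>, as \<open>a\<close> is an isolated solution of \<open>f_exp s w = f_exp s a\<close>.\<close>

lemma inj_on_closure_Omega:
  assumes s: "s > 0" and cont: "continuous_on (ball 0 1) G"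
    and G: "\<And>z. z \<in> ball 0 1 \<Longrightarrow> G z \<in> Omega s"
    and fG: "\<And>z. z \<in> ball 0 1 \<Longrightarrow> f_exp s (G z) = z"
  shows "inj_on (f_exp s) (closure (Omega s))"
proof (rule inj_onI, rule ccontr)
  fix a b assume a: "a \<in> closure (Omega s)" and b: "b \<in> closure (Omega s)"
    and ab: "f_exp s a = f_exp s b" and ne: "a \<noteq> b"
  define u where "u = f_exp s a"
  have fOm: "f_exp s w \<in> ball 0 1" if "w \<in> Omega s" for w using that by (simp add: Omega_def)
  have contf: "continuous_on (closure (Omega s)) (f_exp s)"
    by (intro continuous_on_f_exp one_notin_closure_Omega s)
  have "a \<noteq> 1" using a one_notin_closure_Omega[OF s] by auto
  \<comment> \<open>The only zero of \<open>f_exp s\<close> is 0, so one of the points 0 and 2 has a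
    value other than \<open>u\<close>.\<close>
  have nonconst: "\<exists>w \<in> - {1}. f_exp s w \<noteq> u"
  proof (cases "u = 0")
    case True then show ?thesis by (intro bexI[of _ "2"]) auto
  next
    case False then show ?thesis by (intro bexI[of _ "0"]) auto
  qed
  then obtain b' where b': "b' \<in> - {1}" "f_exp s b' - u \<noteq> 0" by auto
  have "connected (- {1 :: complex})" by (rule connected_punctured_universe) simp
  moreover have "(\<lambda>w. f_exp s w - u) holomorphic_on (- {1})"
    by (intro holomorphic_intros holomorphic_f_exp)
  ultimately obtain r where r: "0 < r" "\<And>w. w \<in> ball a r - {a} \<Longrightarrow> f_exp s w - u \<noteq> 0"
    using isolated_zeros[of "\<lambda>w. f_exp s w - u" "- {1}" a b'] b' \<open>a \<noteq> 1\<close>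
    by (metis ComplI cancel_comm_monoid_add_class.diff_cancel open_Compl closed_singleton singletonD u_def)
  \<comment> \<open>The circle of radius \<open>e\<close> around \<open>a\<close> lies in the disk
    where \<open>a\<close> is the only solution, and leaves \<open>b\<close> outside.\<close>
  define e where "e = min r (dist a b) / 2"
  have e: "0 < e" "e < r" "e < dist a b" using r ne by (auto simp: e_def min_def)
  let ?S = "closure (Omega s) \<inter> sphere a e"
  have "compact ?S" using compact_closure_Omega by (intro compact_Int) auto
  moreover have "continuous_on ?S (\<lambda>w. dist (f_exp s w) u)"
    by (intro continuous_intros continuous_on_subset[OF contf]) auto
  \<comment> \<open>Compactness gives a gap \<open>d\<close> between \<open>u\<close> and the values
    of \<open>f_exp s\<close> on the circle. If the circle misses the closure, any gap will do, and
    1 is taken.\<close>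
  ultimately have "\<exists>d>0. \<forall>w\<in>?S. d \<le> dist (f_exp s w) u"
  proof (cases "?S = {}")
    case False
    assume "compact ?S" "continuous_on ?S (\<lambda>w. dist (f_exp s w) u)"
    then obtain w0 where w0: "w0 \<in> ?S" "\<forall>w\<in>?S. dist (f_exp s w0) u \<le> dist (f_exp s w) u"
      using continuous_attains_inf[of ?S "\<lambda>w. dist (f_exp s w) u"] False by blast
    have "f_exp s w0 \<noteq> u" using w0(1) r(2)[of w0] e by (auto simp: dist_commute)
    with w0(2) show ?thesis by (intro exI[of _ "dist (f_exp s w0) u"]) auto
  qed (auto intro: exI[of _ 1])
  then obtain d where d: "d > 0" "\<And>w. w \<in> ?S \<Longrightarrow> d \<le> dist (f_exp s w) u" by auto
  have near: "\<exists>w\<in>Omega s. dist w c < h \<and> dist (f_exp s w) u < d"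
    if c: "c \<in> closure (Omega s)" "f_exp s c = u" and h: "h > 0" for c h
  proof -
    obtain h' where h': "h' > 0"
      "\<And>w. w \<in> closure (Omega s) \<Longrightarrow> dist w c < h' \<Longrightarrow> dist (f_exp s w) (f_exp s c) < d"
      using contf c(1) d(1) unfolding continuous_on_iff by blast
    obtain w where w: "w \<in> Omega s" "dist w c < min h h'"
      using c(1) h h'(1) unfolding closure_approachable by (metis min_less_iff_conj)
    with h'(2)[of w] c(2) closure_subset[of "Omega s"] show ?thesis by (intro bexI[of _ w]) auto
  qed
  obtain x where x: "x \<in> Omega s" "dist x a < e" "dist (f_exp s x) u < d"
    using near[of a e] a e by (auto simp: u_def)
  obtain y where y: "y \<in> Omega s" "dist y b < dist a b - e" "dist (f_exp s y) u < d"
    using near[of b "dist a b - e"] b e ab by (auto simp: u_def)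
  let ?B = "ball 0 1 \<inter> ball u d"
  have "connected (G ` ?B)"
    by (intro connected_continuous_image continuous_on_subset[OF cont] convex_connected convex_Int) auto
  moreover have "G ` ?B \<inter> ball a e \<noteq> {}"
    using x fOm[of x] right_inverse_onto_Omega[OF s cont G fG x(1)]
    by (metis (no_types, lifting) Int_iff dist_commute empty_iff imageI mem_ball)
  moreover have "y \<in> G ` ?B - ball a e"
  proof -
    have "dist a b \<le> dist a y + dist y b" by (rule dist_triangle)
    with y fOm[of y] right_inverse_onto_Omega[OF s cont G fG y(1)] show ?thesis
      by (metis (no_types, lifting) Int_iff add.commute dist_commute image_eqI mem_ball Diff_iff
          less_diff_eq add_less_cancel_left not_less order_less_trans order_le_less_trans)
  qed
  ultimately have "G ` ?B \<inter> frontier (ball a e) \<noteq> {}"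
    by (intro connected_Int_frontier) auto
  then obtain z where z: "z \<in> ?B" "G z \<in> sphere a e"
    using frontier_ball[of e a] e(1) by blast
  with d(2)[of "G z"] G[of z] fG[of z] closure_subset[of "Omega s"] show False
    by (auto simp: dist_commute)
qed

section \<open>Poisson integrals of measures on the circle\<close>

text \<open>The product \<open>z * \<omega>\<close> follows the convention of \<open>psi\<close>;
  this is the usual Poisson kernel for the boundary point \<open>cnj \<omega>\<close>.\<close>

definition poisson_kernel :: "complex \<Rightarrow> complex \<Rightarrow> real" where
  "poisson_kernel z \<omega> = (1 - (cmod z)\<^sup>2) / (cmod (1 - z * \<omega>))\<^sup>2"

lemma poisson_kernel_eq_Re: "cmod \<omega> = 1 \<Longrightarrow> poisson_kernel z \<omega> = Re ((1 + z * \<omega>) / (1 - z * \<omega>))"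
  by (simp add: Re_cayley poisson_kernel_def norm_mult)

lemma one_minus_mult_neq_0:
  fixes z \<omega> :: complex
  assumes "cmod z < 1" "cmod \<omega> = 1"
  shows "1 - z * \<omega> \<noteq> 0"
  using assms by (metis eq_iff_diff_eq_0 less_irrefl mult.right_neutral norm_mult norm_one)

lemma norm_one_minus_mult_ge:
  fixes z \<omega> :: complex
  assumes "cmod \<omega> = 1"
  shows "1 - cmod z \<le> cmod (1 - z * \<omega>)"
  using norm_triangle_ineq2[of 1 "z * \<omega>"] assms by (simp add: norm_mult)

lemma poisson_kernel_nonneg: "cmod z < 1 \<Longrightarrow> 0 \<le> poisson_kernel z \<omega>"
  by (simp add: poisson_kernel_def abs_square_le_1)

lemma poisson_kernel_le:
  assumes "cmod z < 1" "cmod \<omega> = 1"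
  shows "poisson_kernel z \<omega> \<le> 1 / (1 - cmod z)\<^sup>2"
proof -
  have "(1 - cmod z)\<^sup>2 \<le> (cmod (1 - z * \<omega>))\<^sup>2"
    using assms norm_one_minus_mult_ge[of \<omega> z] by (intro power_mono) auto
  then show ?thesis
    using assms unfolding poisson_kernel_def by (intro frac_le) auto
qed

text \<open>The kernel is the real part of a function holomorphic on the closed disk of radius
  \<open>r\<close> with value 1 at 0, so Cauchy's formula at the centre gives its mean.\<close>

lemma poisson_kernel_mean_value:
  fixes r :: real
  assumes r: "0 < r" "r < 1" and \<omega>: "cmod \<omega> = 1"
  shows "((\<lambda>x. poisson_kernel (r * cis (2 * pi * x)) \<omega>) has_integral 1) {0..1}"
proof -
  let ?h = "\<lambda>z. (1 + z * \<omega>) / (1 - z * \<omega>)" and ?c = "2 * of_real pi * \<i>"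
  have hol: "?h holomorphic_on cball 0 r"
    using r \<omega> one_minus_mult_neq_0 by (intro holomorphic_intros) auto
  have e: "exp (?c * of_real x) = cis (2 * pi * x)" for x
    by (simp add: cis_conv_exp algebra_simps)
  have cp: "circlepath 0 r x = r * cis (2 * pi * x)" for x
    by (simp add: circlepath e)
  have vd: "vector_derivative (circlepath 0 r) (at x within {0..1}) = ?c * (r * cis (2 * pi * x))"
    if "x \<in> {0..1}" for x
    using that by (simp add: vector_derivative_circlepath01 e)
  have "((\<lambda>u. ?h u / (u - 0)) has_contour_integral (2 * of_real pi * \<i> * ?h 0)) (circlepath 0 r)"
    by (rule Cauchy_integral_circlepath)
       (use r in \<open>auto intro: holomorphic_on_imp_continuous_on[OF hol] holomorphic_on_subset[OF hol]\<close>)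
  \<comment> \<open>On the circle the form \<open>du / u\<close> is the constant \<open>?c\<close>
    times \<open>dx\<close>.\<close>
  then have "((\<lambda>x. ?h (r * cis (2 * pi * x)) * ?c) has_integral (?c * ?h 0)) {0..1}"
    unfolding has_contour_integral_def
    by (rule has_integral_eq[rotated])
       (use r in \<open>simp add: vd, simp add: cp\<close>)
  then have "((\<lambda>x. ?h (r * cis (2 * pi * x)) * ?c * inverse ?c) has_integral (?c * ?h 0 * inverse ?c)) {0..1}"
    by (rule has_integral_mult_left)
  moreover have "?c * inverse ?c = 1" by (rule right_inverse) simp
  ultimately have "((\<lambda>x. ?h (r * cis (2 * pi * x))) has_integral 1) {0..1}"
    by (simp only: mult.assoc mult.commute[of "?h 0"]) simp
  from has_integral_Re[OF this] show ?thesis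
    using \<omega> by (simp add: poisson_kernel_eq_Re)
qed

section \<open>Circle averages and the approximate identity\<close>

abbreviation unit_interval :: "real measure" where
  "unit_interval \<equiv> restrict_space lborel {0..1}"

lemma prob_space_unit_interval: "prob_space unit_interval"
  by (rule prob_spaceI) (simp add: emeasure_restrict_space space_restrict_space)

lemma unit_interval_integral_eq:
  fixes f :: "real \<Rightarrow> real"
  assumes "continuous_on {0..1} f" "(f has_integral I) {0..1}"
  shows "(LINT x|unit_interval. f x) = I"
proof -
  have "set_integrable lborel {0..1} f"
    by (rule borel_integrable_atLeastAtMost') (use assms in auto)
  then have "(LINT x:{0..1}|lborel. f x) = integral {0..1} f"
    by (rule set_borel_integral_eq_integral(2))
  then show ?thesis
    using integral_unique[OF assms(2)]
    by (simp add: integral_restrict_space set_lebesgue_integral_def)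
qed

lemma measurable_unit_interval: "f \<in> borel_measurable borel \<Longrightarrow> f \<in> borel_measurable unit_interval"
  by (rule measurable_restrict_space1) simp

lemma continuous_on_poisson_kernel_circle:
  fixes r :: real
  assumes "0 < r" "r < 1" "cmod \<omega> = 1"
  shows "continuous_on S (\<lambda>x. poisson_kernel (r * cis (2 * pi * x)) \<omega>)"
  unfolding poisson_kernel_def
  by (intro continuous_intros) (use assms one_minus_mult_neq_0[of "r * cis (2 * pi * _)" \<omega>] in \<open>auto simp: norm_mult\<close>)

lemma poisson_kernel_circle_integral:
  fixes r :: real
  assumes "0 < r" "r < 1" "cmod \<omega> = 1"
  shows "(LINT x|unit_interval. poisson_kernel (r * cis (2 * pi * x)) \<omega>) = 1"
  using unit_interval_integral_eq[OF continuous_on_poisson_kernel_circle poisson_kernel_mean_value] assms by blast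

lemma poisson_kernel_circle_integrable:
  fixes r :: real
  assumes "0 < r" "r < 1" "cmod \<omega> = 1"
  shows "integrable unit_interval (\<lambda>x. poisson_kernel (r * cis (2 * pi * x)) \<omega>)"
  \<comment> \<open>The integral of a non-integrable function is 0 by convention, whereas this one
    is 1.\<close>
  using poisson_kernel_circle_integral[OF assms] not_integrable_integral_eq by fastforce

lemma poisson_average_integrable:
  fixes g :: "complex \<Rightarrow> real" and r :: real
  assumes g: "continuous_on UNIV g" "\<And>z. 0 \<le> g z" "\<And>z. g z \<le> 1"
    and r: "0 < r" "r < 1" and \<omega>: "cmod \<omega> = 1"
  shows "integrable unit_interval (\<lambda>x. g (cis (- 2 * pi * x)) * poisson_kernel (r * cis (2 * pi * x)) \<omega>)"
proof (rule Bochner_Integration.integrable_bound[OF poisson_kernel_circle_integrable[OF r \<omega>]])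
  have "continuous_on UNIV (\<lambda>x. g (cis (- 2 * pi * x)) * poisson_kernel (r * cis (2 * pi * x)) \<omega>)"
    by (intro continuous_intros continuous_on_poisson_kernel_circle r \<omega> continuous_on_compose2[OF g(1)]) auto
  then show "(\<lambda>x. g (cis (- 2 * pi * x)) * poisson_kernel (r * cis (2 * pi * x)) \<omega>)
      \<in> borel_measurable unit_interval"
    by (intro measurable_unit_interval borel_measurable_continuous_onI)
  have "poisson_kernel (r * cis (2 * pi * x)) \<omega> \<ge> 0" for x
    using r by (intro poisson_kernel_nonneg) (simp add: norm_mult)
  then show "AE x in unit_interval. norm (g (cis (- 2 * pi * x)) * poisson_kernel (r * cis (2 * pi * x)) \<omega>)
      \<le> norm (poisson_kernel (r * cis (2 * pi * x)) \<omega>)"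
    using g by (intro AE_I2) (simp add: abs_mult mult_left_le_one_le)
qed

text \<open>The kernel \<open>poisson_kernel z \<omega>\<close> peaks at \<open>z = 1 / \<omega>\<close>, so \<open>g\<close> is evaluated at conjugate points.\<close>

lemma poisson_average_tendsto:
  fixes g :: "complex \<Rightarrow> real" and r :: "nat \<Rightarrow> real"
  assumes g: "continuous_on UNIV g" "\<And>z. 0 \<le> g z" "\<And>z. g z \<le> 1" and \<omega>: "cmod \<omega> = 1"
    and r: "r \<longlonglongrightarrow> 1" "\<And>n. 0 < r n" "\<And>n. r n < 1"
  shows "(\<lambda>n. LINT x|unit_interval. g (cis (- 2 * pi * x)) *
      poisson_kernel (r n * cis (2 * pi * x)) \<omega>) \<longlonglongrightarrow> g \<omega>"
proof -
  interpret I: prob_space unit_interval by (rule prob_space_unit_interval)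
  define Q where "Q n x = poisson_kernel (r n * cis (2 * pi * x)) \<omega>" for n and x :: real
  have Q: "Q n x = (1 - (r n)\<^sup>2) / (cmod (1 - r n * cis (2 * pi * x) * \<omega>))\<^sup>2" for n x
    by (simp add: Q_def poisson_kernel_def norm_mult)
  have Q0: "Q n x \<ge> 0" for n x
    unfolding Q_def using r(2,3)[of n] by (intro poisson_kernel_nonneg) (simp add: norm_mult)
  have IQ: "(LINT x|unit_interval. Q n x) = 1" and intQ: "integrable unit_interval (Q n)"
    and intgQ: "integrable unit_interval (\<lambda>x. g (cis (- 2 * pi * x)) * Q n x)" for n
    unfolding Q_def
    by (intro poisson_kernel_circle_integral poisson_kernel_circle_integrable
        poisson_average_integrable g r \<omega>)+
  show ?thesis
    unfolding Q_def[symmetric]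
  proof (rule LIMSEQ_I)
    fix e :: real assume e: "e > 0"
    obtain d where d: "d > 0" "\<And>z. dist z \<omega> < d \<Longrightarrow> dist (g z) (g \<omega>) < e / 2"
      using g(1) e unfolding continuous_on_iff by (metis UNIV_I half_gt_zero)
    \<comment> \<open>This expression will bound the kernel at distance at least \<open>d\<close>
      from its peak; it tends to 0.\<close>
    have "(\<lambda>n. (1 - (r n)\<^sup>2) / (d - (1 - r n))\<^sup>2) \<longlonglongrightarrow> (1 - 1\<^sup>2) / (d - (1 - 1))\<^sup>2"
      by (intro tendsto_intros r) (use d in auto)
    then have "\<forall>\<^sub>F n in sequentially. (1 - (r n)\<^sup>2) / (d - (1 - r n))\<^sup>2 < e / 2"
      using e by (intro order_tendstoD) auto
    moreover have "\<forall>\<^sub>F n in sequentially. 1 - r n < d"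
    proof -
      have "(\<lambda>n. 1 - r n) \<longlonglongrightarrow> 1 - 1" by (intro tendsto_intros r)
      then show ?thesis using d by (intro order_tendstoD) auto
    qed
    ultimately have "\<forall>\<^sub>F n in sequentially.
        norm ((LINT x|unit_interval. g (cis (- 2 * pi * x)) * Q n x) - g \<omega>) < e"
    proof eventually_elim
      case (elim n)
      have "(LINT x|unit_interval. g (cis (- 2 * pi * x)) * Q n x) - g \<omega> =
          (LINT x|unit_interval. g (cis (- 2 * pi * x)) * Q n x - g \<omega> * Q n x)"
        by (subst Bochner_Integration.integral_diff) (use intgQ intQ IQ in auto)
      also have "norm \<dots> \<le> (LINT x|unit_interval. norm (g (cis (- 2 * pi * x)) * Q n x - g \<omega> * Q n x))"
        by (rule integral_norm_bound)
      \<comment> \<open>Near the peak the continuity of \<open>g\<close> gives the first summand;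
        away from it the smallness of the kernel gives the second, as values of \<open>g\<close>
        differ by at most 1.\<close>
      also have "\<dots> \<le> (LINT x|unit_interval. e / 2 * Q n x + (1 - (r n)\<^sup>2) / (d - (1 - r n))\<^sup>2)"
      proof (rule integral_mono)
        fix x
        let ?z = "cis (- 2 * pi * x)" and ?u = "cis (2 * pi * x)"
        have Qn: "0 \<le> (1 - (r n)\<^sup>2)" using r(2,3)[of n] by (auto simp: abs_square_le_1)
        have eq: "norm (g ?z * Q n x - g \<omega> * Q n x) = dist (g ?z) (g \<omega>) * Q n x"
          using Q0[of n x] by (simp add: dist_norm abs_mult flip: left_diff_distrib)
        show "norm (g ?z * Q n x - g \<omega> * Q n x) \<le> e / 2 * Q n x + (1 - (r n)\<^sup>2) / (d - (1 - r n))\<^sup>2"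
        proof (cases "dist ?z \<omega> < d")
          case True
          then have "dist (g ?z) (g \<omega>) * Q n x \<le> e / 2 * Q n x"
            using d(2)[of ?z] Q0 by (intro mult_right_mono) auto
          then show ?thesis using eq Qn by (simp add: add_increasing2)
        next
          case False
          \<comment> \<open>The factor \<open>?u\<close> has modulus 1 and is inverse to
            \<open>?z\<close>.\<close>
          have "dist ?z \<omega> = cmod (?u * (?z - \<omega>))"
            by (simp add: dist_norm norm_mult)
          also have "\<dots> = cmod (1 - ?u * \<omega>)"
            by (simp add: right_diff_distrib cis_mult)
          finally have "d \<le> cmod (1 - ?u * \<omega>)" using False by simp
          \<comment> \<open>Passing from the unit circle to radius \<open>r n\<close> costs at most
            \<open>1 - r n\<close>.\<close>
          also have "1 - ?u * \<omega> = (1 - r n * ?u * \<omega>) + (r n - 1) * (?u * \<omega>)"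
            by (simp add: algebra_simps)
          also have "cmod \<dots> \<le> cmod (1 - r n * ?u * \<omega>) + cmod ((r n - 1) * (?u * \<omega>))"
            by (rule norm_triangle_ineq)
          also have "cmod ((r n - 1) * (?u * \<omega>)) = 1 - r n"
            using r(3)[of n] \<omega> norm_of_real[of "r n - 1", where 'a = complex] by (simp add: norm_mult)
          finally have "d - (1 - r n) \<le> cmod (1 - r n * ?u * \<omega>)" by simp
          then have "Q n x \<le> (1 - (r n)\<^sup>2) / (d - (1 - r n))\<^sup>2"
            unfolding Q using elim Qn by (intro divide_left_mono power_mono mult_pos_pos zero_less_power) auto
          moreover have "dist (g ?z) (g \<omega>) * Q n x \<le> 1 * Q n x"
            using g(2,3)[of ?z] g(2,3)[of \<omega>] Q0 by (intro mult_right_mono) (auto simp: dist_real_def)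
          ultimately show ?thesis using eq Q0[of n x] e by (simp add: add_increasing)
        qed
      qed (use intgQ intQ in auto)
      also have "\<dots> = e / 2 * (LINT x|unit_interval. Q n x) + (1 - (r n)\<^sup>2) / (d - (1 - r n))\<^sup>2"
        by (subst Bochner_Integration.integral_add) (use intQ I.prob_space in auto)
      also have "\<dots> < e" using elim(1) unfolding IQ by linarith
      finally show ?case .
    qed
    then show "\<exists>no. \<forall>n\<ge>no. norm ((LINT x|unit_interval. g (cis (- 2 * pi * x)) * Q n x) - g \<omega>) < e"
      by (simp add: eventually_sequentially)
  qed
qed

section \<open>Measures on the circle as limits of their Poisson integrals\<close>

lemma space_circle_measure: "sets M = sets circle_borel \<Longrightarrow> space M = sphere 0 1"
  by (drule sets_eq_imp_space_eq) (simp add: circle_borel_def space_restrict_space)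

lemma measurable_id_circle_measure:
  assumes "sets M = sets circle_borel"
  shows "(\<lambda>\<omega>. \<omega>) \<in> borel_measurable M"
  by (subst measurable_cong_sets[OF assms refl]) (simp add: circle_borel_def measurable_restrict_space1)

definition poisson :: "complex measure \<Rightarrow> complex \<Rightarrow> real" where
  "poisson M z = (LINT \<omega>|M. poisson_kernel z \<omega>)"

lemma measurable_poisson_kernel:
  assumes "sets M = sets circle_borel"
  shows "poisson_kernel z \<in> borel_measurable M"
  using measurable_id_circle_measure[OF assms] unfolding poisson_kernel_def by measurable

lemma poisson_kernel_integrable:
  assumes "finite_measure M" "sets M = sets circle_borel" "cmod z < 1"
  shows "integrable M (poisson_kernel z)"
proof -
  interpret finite_measure M by fact
  show ?thesis
    using poisson_kernel_le[OF assms(3)] poisson_kernel_nonneg[OF assms(3)] space_circle_measure[OF assms(2)]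
    by (intro integrable_const_bound[of _ "1 / (1 - cmod z)\<^sup>2"] AE_I2 measurable_poisson_kernel assms) auto
qed

text \<open>By Fubini the average equals the integral over \<open>M\<close> of the kernel averages
  of \<open>g\<close>. These tend to \<open>g \<omega>\<close> and stay between 0 and 1, so
  dominated convergence applies.\<close>

lemma poisson_integral_tendsto:
  fixes g :: "complex \<Rightarrow> real" and r :: "nat \<Rightarrow> real"
  assumes M: "finite_measure M" "sets M = sets circle_borel"
    and g: "continuous_on UNIV g" "\<And>z. 0 \<le> g z" "\<And>z. g z \<le> 1"
    and r: "r \<longlonglongrightarrow> 1" "\<And>n. 0 < r n" "\<And>n. r n < 1"
  shows "(\<lambda>n. LINT x|unit_interval. g (cis (- 2 * pi * x)) * poisson M (r n * cis (2 * pi * x)))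
      \<longlonglongrightarrow> (LINT \<omega>|M. g \<omega>)"
    and "integrable unit_interval (\<lambda>x. g (cis (- 2 * pi * x)) * poisson M (r n * cis (2 * pi * x)))"
proof -
  interpret M: finite_measure M by fact
  interpret I: prob_space unit_interval by (rule prob_space_unit_interval)
  interpret P: pair_sigma_finite M unit_interval ..
  interpret MI: finite_measure "M \<Otimes>\<^sub>M unit_interval"
    by (rule finite_measure_pair_measure) (unfold_locales)
  note [measurable] = measurable_id_circle_measure[OF M(2)] borel_measurable_continuous_onI[OF g(1)]
  have [measurable]: "(\<lambda>x. x) \<in> borel_measurable unit_interval" "cis \<in> borel_measurable borel"
    by (auto intro!: measurable_unit_interval borel_measurable_continuous_onI continuous_intros)
  let ?Q = "\<lambda>n \<omega> x. g (cis (- 2 * pi * x)) * poisson_kernel (r n * cis (2 * pi * x)) \<omega>"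
  have space: "space M = sphere 0 1" by (rule space_circle_measure[OF M(2)])
  have rn: "cmod (r n * cis x) < 1" for n x using r(2,3)[of n] by (simp add: norm_mult)
  have meas: "(\<lambda>(\<omega>, x). ?Q n \<omega> x) \<in> borel_measurable (M \<Otimes>\<^sub>M unit_interval)" for n
    unfolding poisson_kernel_def by measurable
  \<comment> \<open>For fixed \<open>n\<close> the kernel is bounded, and the product measure is
    finite.\<close>
  have intQ: "integrable (M \<Otimes>\<^sub>M unit_interval) (\<lambda>(\<omega>, x). ?Q n \<omega> x)" for n
  proof (rule MI.integrable_const_bound[OF AE_I2 meas])
    fix p assume "p \<in> space (M \<Otimes>\<^sub>M unit_interval)"
    then obtain \<omega> x where p: "p = (\<omega>, x)" "cmod \<omega> = 1"
      using space by (auto simp: space_pair_measure)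
    have "?Q n \<omega> x \<le> 1 * (1 / (1 - cmod (r n * cis (2 * pi * x)))\<^sup>2)"
      by (intro mult_mono g poisson_kernel_le poisson_kernel_nonneg rn p) auto
    also have "cmod (r n * cis (2 * pi * x)) = r n" using r(2)[of n] by (simp add: norm_mult)
    finally show "norm (case p of (\<omega>, x) \<Rightarrow> ?Q n \<omega> x) \<le> 1 / (1 - r n)\<^sup>2"
      using g(2) poisson_kernel_nonneg[OF rn] by (simp add: p abs_mult)
  qed
  have eq: "(LINT \<omega>|M. ?Q n \<omega> x) = g (cis (- 2 * pi * x)) * poisson M (r n * cis (2 * pi * x))" for n x
    unfolding poisson_def by (rule integral_mult_right_zero)
  show "integrable unit_interval (\<lambda>x. g (cis (- 2 * pi * x)) * poisson M (r n * cis (2 * pi * x)))"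
    using P.integrable_snd[OF intQ[of n]] by (simp only: eq)
  have "(\<lambda>n. LINT \<omega>|M. LINT x|unit_interval. ?Q n \<omega> x) \<longlonglongrightarrow> (LINT \<omega>|M. g \<omega>)"
  proof (rule integral_dominated_convergence[where w = "\<lambda>_. 1"])
    show "(\<lambda>\<omega>. LINT x|unit_interval. ?Q n \<omega> x) \<in> borel_measurable M" for n
      by (rule I.borel_measurable_lebesgue_integral[OF meas])
    show "AE \<omega> in M. (\<lambda>n. LINT x|unit_interval. ?Q n \<omega> x) \<longlonglongrightarrow> g \<omega>"
      by (intro AE_I2 poisson_average_tendsto g r) (simp add: space)
    show "AE \<omega> in M. norm (LINT x|unit_interval. ?Q n \<omega> x) \<le> 1" for n
    proof (rule AE_I2)
      fix \<omega> assume "\<omega> \<in> space M"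
      then have \<omega>: "cmod \<omega> = 1" by (simp add: space)
      have "(LINT x|unit_interval. ?Q n \<omega> x) \<le> (LINT x|unit_interval. poisson_kernel (r n * cis (2 * pi * x)) \<omega>)"
        by (intro integral_mono poisson_average_integrable poisson_kernel_circle_integrable g r \<omega>
            mult_left_le_one_le poisson_kernel_nonneg rn)
      moreover have "0 \<le> (LINT x|unit_interval. ?Q n \<omega> x)"
        by (intro Bochner_Integration.integral_nonneg mult_nonneg_nonneg g poisson_kernel_nonneg rn)
      ultimately show "norm (LINT x|unit_interval. ?Q n \<omega> x) \<le> 1"
        using poisson_kernel_circle_integral[OF r(2,3) \<omega>] by simp
    qed
  qed measurable
  also have "(\<lambda>n. LINT \<omega>|M. LINT x|unit_interval. ?Q n \<omega> x) =
      (\<lambda>n. LINT x|unit_interval. LINT \<omega>|M. ?Q n \<omega> x)"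
    by (intro ext P.Fubini_integral[symmetric] intQ)
  finally show "(\<lambda>n. LINT x|unit_interval. g (cis (- 2 * pi * x)) * poisson M (r n * cis (2 * pi * x)))
      \<longlonglongrightarrow> (LINT \<omega>|M. g \<omega>)"
    by (simp only: eq)
qed

section \<open>From inequalities between Poisson integrals to bounded densities\<close>

lemma integral_le_of_poisson_le:
  fixes g :: "complex \<Rightarrow> real"
  assumes M: "finite_measure M" "sets M = sets circle_borel"
    and N: "finite_measure N" "sets N = sets circle_borel"
    and le: "\<And>z. cmod z < 1 \<Longrightarrow> poisson M z \<le> C * poisson N z"
    and g: "continuous_on UNIV g" "\<And>z. 0 \<le> g z" "\<And>z. g z \<le> 1"
  shows "(LINT \<omega>|M. g \<omega>) \<le> C * (LINT \<omega>|N. g \<omega>)"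
proof -
  \<comment> \<open>The shift by 2 puts every radius, including the first, strictly between 0 and
    1.\<close>
  define r :: "nat \<Rightarrow> real" where "r n = 1 - 1 / (real n + 2)" for n
  have r: "r \<longlonglongrightarrow> 1" "\<And>n. 0 < r n" "\<And>n. r n < 1"
    unfolding r_def by (real_asymp, auto)
  note limM = poisson_integral_tendsto[OF M g r] and limN = poisson_integral_tendsto[OF N g r]
  show ?thesis
  proof (rule LIMSEQ_le[OF limM(1) tendsto_mult_left[OF limN(1), of C]], intro exI[of _ 0] allI impI)
    fix n
    have "(LINT x|unit_interval. g (cis (- 2 * pi * x)) * poisson M (r n * cis (2 * pi * x)))
      \<le> (LINT x|unit_interval. C * (g (cis (- 2 * pi * x)) * poisson N (r n * cis (2 * pi * x))))"
    proof (intro integral_mono limM integrable_mult_right limN)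
      fix x
      have "poisson M (r n * cis (2 * pi * x)) \<le> C * poisson N (r n * cis (2 * pi * x))"
        using r(2,3)[of n] by (intro le) (simp add: norm_mult)
      from mult_left_mono[OF this g(2)[of "cis (- 2 * pi * x)"]]
      show "g (cis (- 2 * pi * x)) * poisson M (r n * cis (2 * pi * x))
          \<le> C * (g (cis (- 2 * pi * x)) * poisson N (r n * cis (2 * pi * x)))"
        by (simp add: mult_ac)
    qed
    then show "(LINT x|unit_interval. g (cis (- 2 * pi * x)) * poisson M (r n * cis (2 * pi * x)))
      \<le> C * (LINT x|unit_interval. g (cis (- 2 * pi * x)) * poisson N (r n * cis (2 * pi * x)))"
      by simp
  qed
qed

text \<open>Continuous functions decreasing to the indicator of a compact set give the inequality on
  compact sets; inner regularity extends it to all measurable sets.\<close>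

lemma emeasure_le_of_poisson_le:
  assumes M: "finite_measure M" "sets M = sets circle_borel"
    and N: "finite_measure N" "sets N = sets circle_borel"
    and le: "\<And>z. cmod z < 1 \<Longrightarrow> poisson M z \<le> C * poisson N z"
    and C: "C \<ge> 0" and A: "A \<in> sets M"
  shows "emeasure M A \<le> ennreal C * emeasure N A"
proof -
  interpret M: finite_measure M by fact
  interpret N: finite_measure N by fact
  let ?S = "sphere 0 1 :: complex set"
  have space: "space M = ?S" "space N = ?S" using space_circle_measure M N by auto
  have sets: "B \<in> sets M \<longleftrightarrow> B \<subseteq> ?S \<and> B \<in> sets borel" "B \<in> sets N \<longleftrightarrow> B \<subseteq> ?S \<and> B \<in> sets borel" for B
    using M(2) N(2) by (auto simp: circle_borel_def sets_restrict_space_iff)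
  have compact_le: "emeasure M (K \<inter> ?S) \<le> ennreal C * emeasure N (K \<inter> ?S)" if K: "compact K" for K
  \<comment> \<open>The empty set is treated apart because \<open>infdist\<close> to it is 0 by
    convention, so the functions \<open>g n\<close> would not tend to its indicator.\<close>
  proof (cases "K \<inter> ?S = {}")
    case False
    let ?K = "K \<inter> ?S"
    have clK: "closed ?K" using K by (intro closed_Int compact_imp_closed) auto
    define g where "g n \<omega> = max 0 (1 - real n * infdist \<omega> ?K)" for n :: nat and \<omega> :: complex
    have g: "continuous_on UNIV (g n)" "\<And>z. 0 \<le> g n z" "\<And>z. g n z \<le> 1" for n
      unfolding g_def by (auto intro!: continuous_intros simp: infdist_nonneg)
    have lim: "(\<lambda>n. LINT \<omega>|L. g n \<omega>) \<longlonglongrightarrow> measure L ?K"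
      if L: "finite_measure L" "sets L = sets circle_borel" for L
    proof -
      interpret L: finite_measure L by fact
      have "(\<lambda>n. LINT \<omega>|L. g n \<omega>) \<longlonglongrightarrow> (LINT \<omega>|L. indicator ?K \<omega>)"
      proof (rule integral_dominated_convergence[where w = "\<lambda>_. 1"])
        show "(\<lambda>\<omega>. indicator ?K \<omega> :: real) \<in> borel_measurable L"
          by (rule measurable_compose[OF measurable_id_circle_measure[OF L(2)]])
             (use clK in \<open>auto intro!: borel_measurable_indicator\<close>)
        show "g n \<in> borel_measurable L" for n
          using measurable_compose[OF measurable_id_circle_measure[OF L(2)]
              borel_measurable_continuous_onI[OF g(1)]] .
        show "AE \<omega> in L. (\<lambda>n. g n \<omega>) \<longlonglongrightarrow> indicator ?K \<omega>"
        proof (rule AE_I2)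
          fix \<omega>
          show "(\<lambda>n. g n \<omega>) \<longlonglongrightarrow> indicator ?K \<omega>"
          proof (cases "\<omega> \<in> ?K")
            case True
            then show ?thesis by (simp add: g_def)
          next
            case w: False
            then have d: "infdist \<omega> ?K > 0"
              using clK False by (simp add: infdist_pos_not_in_closed)
            obtain k :: nat where k: "1 < real k * infdist \<omega> ?K"
              using reals_Archimedean3[OF d] by blast
            have "g n \<omega> = 0" if "n \<ge> k" for n
            proof -
              have "1 < real n * infdist \<omega> ?K"
                using k that mult_right_mono[of "real k" "real n" "infdist \<omega> ?K"] d by linarith
              then show ?thesis by (simp add: g_def)
            qed
            then have "\<forall>\<^sub>F n in sequentially. g n \<omega> = 0" by (auto simp: eventually_sequentially)
            then show ?thesis using w by (simp add: tendsto_eventually)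
          qed
        qed
        show "AE \<omega> in L. norm (g n \<omega>) \<le> 1" for n using g(2,3) by simp
      qed simp
      moreover have "?K \<inter> space L = ?K" using space_circle_measure[OF L(2)] by auto
      ultimately show ?thesis by simp
    qed
    have "measure M ?K \<le> C * measure N ?K"
      by (rule LIMSEQ_le[OF lim[OF M] tendsto_mult_left[OF lim[OF N], of C]])
         (use integral_le_of_poisson_le[OF M N le g] in auto)
    then show ?thesis
      using C by (simp add: M.emeasure_eq_measure N.emeasure_eq_measure flip: ennreal_mult)
  qed simp
  \<comment> \<open>Inner regularity concerns Borel measures on the whole plane, so \<open>M\<close>
    is pushed forward along the inclusion.\<close>
  let ?M = "distr M borel (\<lambda>x. x)"
  have dist: "emeasure ?M B = emeasure M (B \<inter> ?S)" if "B \<in> sets borel" for B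
    using that by (simp add: emeasure_distr measurable_id_circle_measure[OF M(2)] space)
  have "finite_measure ?M"
    by (rule M.finite_measure_distr) (rule measurable_id_circle_measure[OF M(2)])
  then have "emeasure ?M A = (SUP K \<in> {K. K \<subseteq> A \<and> compact K}. emeasure ?M K)"
    using A finite_measure.emeasure_finite by (intro inner_regular) (auto simp: sets)
  also have "\<dots> \<le> ennreal C * emeasure N A"
  proof (rule SUP_least)
    fix K assume K: "K \<in> {K. K \<subseteq> A \<and> compact K}"
    have "emeasure ?M K = emeasure M (K \<inter> ?S)"
      using K by (intro dist) (auto intro: borel_compact)
    also have "\<dots> \<le> ennreal C * emeasure N (K \<inter> ?S)"
      using K by (intro compact_le) auto
    also have "\<dots> \<le> ennreal C * emeasure N A"
      using K A by (intro mult_left_mono emeasure_mono) (auto simp: sets)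
    finally show "emeasure ?M K \<le> ennreal C * emeasure N A" .
  qed
  also have "emeasure ?M A = emeasure M A"
    using A by (subst dist) (auto simp: sets Int_absorb2)
  finally show ?thesis .
qed

text \<open>The Radon-Nikodym derivative can exceed the constant only on a null set, since on the
  set where it does the second measure would otherwise be too large.\<close>

lemma ac_bounded_densityI:
  assumes M: "finite_measure M" and N: "finite_measure N" and sets: "sets N = sets M"
    and le: "\<And>A. A \<in> sets M \<Longrightarrow> emeasure N A \<le> ennreal C * emeasure M A"
  shows "ac_bounded_density M N"
proof -
  interpret M: finite_measure M by fact
  interpret N: finite_measure N by fact
  \<comment> \<open>A negative \<open>C\<close> is the same as 0 under \<open>ennreal\<close>; the
    bound on a nonnegative real density must be nonnegative.\<close>
  define D where "D = max 0 C"
  have D: "D \<ge> 0" "ennreal C = ennreal D" by (auto simp: D_def max_def ennreal_neg)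
  have ac: "absolutely_continuous M N"
    unfolding absolutely_continuous_def
  proof
    fix A assume "A \<in> null_sets M"
    with le[of A] show "A \<in> null_sets N" by (auto simp: null_sets_def sets)
  qed
  define R where "R = RN_deriv M N"
  have [measurable]: "R \<in> borel_measurable M" by (simp add: R_def)
  have dens: "density M R = N" unfolding R_def by (rule M.density_RN_deriv[OF ac sets])
  define A where "A = {x \<in> space M. ennreal D < R x}"
  have [measurable]: "A \<in> sets M" unfolding A_def by measurable
  have IC: "(\<integral>\<^sup>+x. ennreal D * indicator A x \<partial>M) = ennreal D * emeasure M A"
    by (simp add: nn_integral_cmult_indicator)
  \<comment> \<open>The excess of \<open>R\<close> over \<open>D\<close> on \<open>A\<close> has
    integral \<open>emeasure N A - ennreal D * emeasure M A\<close>, which is 0 by \<open>le\<close>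
    because subtraction in \<open>ennreal\<close> is truncated.\<close>
  have "(\<integral>\<^sup>+x. R x * indicator A x - ennreal D * indicator A x \<partial>M) =
      (\<integral>\<^sup>+x. R x * indicator A x \<partial>M) - (\<integral>\<^sup>+x. ennreal D * indicator A x \<partial>M)"
  proof (rule nn_integral_diff)
    show "(\<integral>\<^sup>+x. ennreal D * indicator A x \<partial>M) \<noteq> \<infinity>"
      unfolding IC by (simp add: ennreal_mult_eq_top_iff M.emeasure_finite)
    show "AE x in M. ennreal D * indicator A x \<le> R x * indicator A x"
      by (intro AE_I2) (auto simp: A_def indicator_def)
  qed measurable
  also have "(\<integral>\<^sup>+x. R x * indicator A x \<partial>M) = emeasure N A"
    by (subst dens[symmetric], subst emeasure_density) auto
  also have "emeasure N A - (\<integral>\<^sup>+x. ennreal D * indicator A x \<partial>M) = 0"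
    unfolding IC using le[of A] D by (simp add: diff_eq_0_iff_ennreal N.emeasure_finite less_top[symmetric])
  finally have "AE x in M. R x * indicator A x - ennreal D * indicator A x = 0"
    by (subst (asm) nn_integral_0_iff_AE) auto
  then have AE: "AE x in M. R x \<le> ennreal D"
  proof (rule AE_mp, intro AE_I2 impI)
    fix x assume x: "x \<in> space M" "R x * indicator A x - ennreal D * indicator A x = 0"
    show "R x \<le> ennreal D"
    proof (rule ccontr)
      assume "\<not> R x \<le> ennreal D"
      then have "x \<in> A" "ennreal D < R x" using x by (auto simp: A_def)
      then show False using x(2) by (auto simp: diff_eq_0_iff_ennreal)
    qed
  qed
  \<comment> \<open>Truncation makes the bound hold at every point and changes \<open>R\<close> only
    on a null set.\<close>
  let ?g = "\<lambda>x. min D (enn2real (R x))"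
  have "density M (\<lambda>x. ennreal (?g x)) = density M R"
  proof (rule density_cong)
    show "AE x in M. ennreal (?g x) = R x"
      using AE
    proof (rule AE_mp, intro AE_I2 impI)
      fix x assume "R x \<le> ennreal D"
      moreover from this have "R x \<noteq> \<top>" by (auto simp: top_unique)
      moreover from calculation D have "enn2real (R x) \<le> D" by (simp add: enn2real_leI)
      ultimately show "ennreal (?g x) = R x"
        by (simp add: min_absorb2 less_top)
    qed
  qed measurable
  with ac D dens show ?thesis
    unfolding ac_bounded_density_def
    by (intro conjI exI[of _ ?g] exI[of _ D]) auto
qed

lemma measure_support_mono:
  assumes "absolutely_continuous M N" "sets M = sets circle_borel" "sets N = sets circle_borel"
  shows "measure_support N \<subseteq> measure_support M"
proof
  fix x assume x: "x \<in> measure_support N"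
  have space: "space M = sphere 0 1" "space N = sphere 0 1"
    using space_circle_measure assms by auto
  have "emeasure M (U \<inter> sphere 0 1) > 0" if "open U" "x \<in> U" for U
  proof (rule ccontr)
    assume "\<not> emeasure M (U \<inter> sphere 0 1) > 0"
    then have "U \<inter> sphere 0 1 \<in> null_sets M"
      using that assms by (auto simp: null_sets_def circle_borel_def sets_restrict_space_iff)
    then have "U \<inter> sphere 0 1 \<in> null_sets N" using assms by (auto simp: absolutely_continuous_def)
    with x that show False by (auto simp: measure_support_def space null_sets_def)
  qed
  with x show "x \<in> measure_support M" by (auto simp: measure_support_def space)
qed

section \<open>Poisson integrals in terms of \<open>psi\<close>\<close>

lemma psi_integrable:
  assumes M: "prob_on_circle M" and z: "cmod z < 1"
  shows "integrable M (\<lambda>\<omega>. \<omega> * z / (1 - \<omega> * z))"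
proof -
  interpret prob_space M using M by (simp add: prob_on_circle_def)
  have sets: "sets M = sets circle_borel" using M by (simp add: prob_on_circle_def)
  note [measurable] = measurable_id_circle_measure[OF sets]
  show ?thesis
  proof (rule integrable_const_bound[of _ "1 / (1 - cmod z)"], rule AE_I2)
    fix \<omega> assume "\<omega> \<in> space M"
    then have "cmod \<omega> = 1" using space_circle_measure[OF sets] by simp
    then show "norm (\<omega> * z / (1 - \<omega> * z)) \<le> 1 / (1 - cmod z)"
      using norm_one_minus_mult_ge[of \<omega> z] z
      by (auto simp: norm_divide norm_mult mult.commute intro!: frac_le)
  qed measurable
qed

lemma poisson_eq_psi:
  assumes M: "prob_on_circle M" and z: "cmod z < 1"
  shows "poisson M z = 1 + 2 * Re (psi M z)"
proof -
  interpret prob_space M using M by (simp add: prob_on_circle_def)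
  have sets: "sets M = sets circle_borel" using M by (simp add: prob_on_circle_def)
  have "poisson M z = (LINT \<omega>|M. 1 + 2 * Re (\<omega> * z / (1 - \<omega> * z)))"
    unfolding poisson_def
  proof (rule Bochner_Integration.integral_cong[OF refl])
    fix \<omega> assume "\<omega> \<in> space M"
    then have \<omega>: "cmod \<omega> = 1" using space_circle_measure[OF sets] by simp
    have "(1 + z * \<omega>) / (1 - z * \<omega>) = 1 + 2 * (\<omega> * z / (1 - \<omega> * z))"
      using one_minus_mult_neq_0[OF z \<omega>] by (simp add: field_simps)
    then have "Re ((1 + z * \<omega>) / (1 - z * \<omega>)) = Re (1 + 2 * (\<omega> * z / (1 - \<omega> * z)))" by (rule arg_cong)
    also have "\<dots> = 1 + 2 * Re (\<omega> * z / (1 - \<omega> * z))"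
      by (simp only: plus_complex.sel one_complex.sel mult_2)
    finally show "poisson_kernel z \<omega> = 1 + 2 * Re (\<omega> * z / (1 - \<omega> * z))"
      by (simp add: poisson_kernel_eq_Re[OF \<omega>])
  qed
  also have "\<dots> = 1 + 2 * Re (psi M z)"
    using psi_integrable[OF M z] prob_space unfolding psi_def
    by (subst Bochner_Integration.integral_add) (auto intro!: integrable_Re integral_Re)
  finally show ?thesis .
qed

lemma poisson_pos:
  assumes M: "prob_on_circle M" and z: "cmod z < 1"
  shows "poisson M z > 0"
proof -
  interpret prob_space M using M by (simp add: prob_on_circle_def)
  have sets: "sets M = sets circle_borel" using M by (simp add: prob_on_circle_def)
  have z2: "0 < 1 - (cmod z)\<^sup>2" using z by (simp add: abs_square_less_1)
  \<comment> \<open>The denominator of the kernel is at most 4, which bounds it below uniformly in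
    \<omega>.\<close>
  have "(1 - (cmod z)\<^sup>2) / 2\<^sup>2 \<le> poisson M z"
    unfolding poisson_def
  proof (rule integral_ge_const[OF poisson_kernel_integrable[OF finite_measure_axioms sets z]], rule AE_I2)
    fix \<omega> assume "\<omega> \<in> space M"
    then have \<omega>: "cmod \<omega> = 1" using space_circle_measure[OF sets] by simp
    have "cmod (1 - z * \<omega>) \<le> 2"
      using norm_triangle_ineq4[of 1 "z * \<omega>"] z \<omega> by (simp add: norm_mult)
    then show "(1 - (cmod z)\<^sup>2) / 2\<^sup>2 \<le> poisson_kernel z \<omega>"
      unfolding poisson_kernel_def using z2 one_minus_mult_neq_0[OF z \<omega>]
      by (intro divide_left_mono power_mono mult_pos_pos zero_less_power) auto
  qed
  with z2 show ?thesis by (smt (verit) divide_pos_pos zero_less_power)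
qed

text \<open>The integrands at two points differ by a multiple of \<open>y - z\<close> that is
  bounded uniformly in \<omega>, so \<open>psi M\<close> is locally Lipschitz.\<close>

lemma continuous_on_psi:
  assumes M: "prob_on_circle M"
  shows "continuous_on (ball 0 1) (psi M)"
proof (rule continuous_at_imp_continuous_on, rule ballI)
  interpret prob_space M using M by (simp add: prob_on_circle_def)
  have space: "space M = sphere 0 1"
    using M by (intro space_circle_measure) (simp add: prob_on_circle_def)
  fix z :: complex assume z: "z \<in> ball 0 1"
  have bound: "dist (psi M y) (psi M z) \<le> cmod (y - z) / ((1 - cmod y) * (1 - cmod z))"
    if y: "y \<in> ball 0 1" for y
  proof -
    let ?h = "\<lambda>z \<omega>. \<omega> * z / (1 - \<omega> * z)"
    have int: "integrable M (?h y)" "integrable M (?h z)"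
      using psi_integrable[OF M] y z by auto
    have "norm (LINT \<omega>|M. ?h y \<omega> - ?h z \<omega>) \<le> (LINT \<omega>|M. norm (?h y \<omega> - ?h z \<omega>))"
      by (rule integral_norm_bound)
    also have "\<dots> \<le> cmod (y - z) / ((1 - cmod y) * (1 - cmod z))"
    proof (rule integral_le_const, use int in simp, rule AE_I2)
      fix \<omega> assume "\<omega> \<in> space M"
      then have \<omega>: "cmod \<omega> = 1" by (simp add: space)
      have nz: "1 - \<omega> * y \<noteq> 0" "1 - \<omega> * z \<noteq> 0"
        using one_minus_mult_neq_0[OF _ \<omega>, of y] one_minus_mult_neq_0[OF _ \<omega>, of z] y z
        by (auto simp: mult.commute)
      then have "?h y \<omega> - ?h z \<omega> = \<omega> * (y - z) / ((1 - \<omega> * y) * (1 - \<omega> * z))"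
        by (simp add: divide_simps) (simp add: algebra_simps)
      also have "cmod \<dots> = cmod (y - z) / (cmod (1 - y * \<omega>) * cmod (1 - z * \<omega>))"
        using \<omega> by (simp add: norm_divide norm_mult mult.commute)
      also have "\<dots> \<le> cmod (y - z) / ((1 - cmod y) * (1 - cmod z))"
        using norm_one_minus_mult_ge[OF \<omega>, of y] norm_one_minus_mult_ge[OF \<omega>, of z] y z
        by (intro frac_le mult_mono mult_pos_pos) auto
      finally show "norm (?h y \<omega> - ?h z \<omega>) \<le> cmod (y - z) / ((1 - cmod y) * (1 - cmod z))" .
    qed
    finally show ?thesis
      using int by (simp add: dist_norm psi_def)
  qed
  have "((\<lambda>y. cmod (y - z) / ((1 - cmod y) * (1 - cmod z))) \<longlongrightarrow>
      cmod (z - z) / ((1 - cmod z) * (1 - cmod z))) (at z)"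
    by (intro tendsto_intros) (use z in auto)
  then have lim: "((\<lambda>y. cmod (y - z) / ((1 - cmod y) * (1 - cmod z))) \<longlongrightarrow> 0) (at z)"
    by simp
  have "\<forall>\<^sub>F y in at z. y \<in> ball 0 1"
    using z by (intro eventually_at_in_open') auto
  then have "\<forall>\<^sub>F y in at z. norm (dist (psi M y) (psi M z)) \<le> cmod (y - z) / ((1 - cmod y) * (1 - cmod z))"
    by eventually_elim (use bound in auto)
  then have "((\<lambda>y. dist (psi M y) (psi M z)) \<longlongrightarrow> 0) (at z)"
    by (rule Lim_null_comparison[OF _ lim])
  then show "isCont (psi M) z"
    unfolding isCont_def by (subst tendsto_dist_iff)
qed

lemma poisson_eq_of_psi_eq:
  assumes "prob_on_circle M" "cmod z < 1" "psi M z = v / (1 - v)" "v \<noteq> 1"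
  shows "poisson M z = (1 - (cmod v)\<^sup>2) / (cmod (1 - v))\<^sup>2"
proof -
  have "1 + 2 * psi M z = (1 + v) / (1 - v)"
    unfolding assms(3) using assms(4) by (simp add: divide_simps)
  then have "Re (1 + 2 * psi M z) = Re ((1 + v) / (1 - v))" by (rule arg_cong)
  then show ?thesis
    using poisson_eq_psi[OF assms(1,2)] by (simp add: Re_cayley)
qed

text \<open>Both claims follow from \<open>Re (psi M z) > - 1 / 2\<close>, which is the positivity
  of the Poisson integral.\<close>

lemma norm_psi_quotient_less_1:
  assumes "prob_on_circle M" "cmod z < 1"
  shows "1 + psi M z \<noteq> 0" "cmod (psi M z / (1 + psi M z)) < 1"
proof -
  have p: "0 < 1 + 2 * Re (psi M z)" using poisson_pos[OF assms] poisson_eq_psi[OF assms] by simp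
  then have "Re (1 + psi M z) > 0" by simp
  then show nz: "1 + psi M z \<noteq> 0" by (metis less_irrefl zero_complex.sel(1))
  have "(cmod (psi M z))\<^sup>2 < (cmod (1 + psi M z))\<^sup>2"
    using p unfolding cmod_power2 by (simp add: power2_eq_square algebra_simps)
  then show "cmod (psi M z / (1 + psi M z)) < 1"
    using nz power_less_imp_less_base[of "cmod (psi M z)" 2] by (simp add: norm_divide)
qed

section \<open>Comparison of the Poisson integrals\<close>

text \<open>With \<open>p = cmod w\<close> and \<open>P\<close> the Poisson kernel of
  \<open>w\<close> at 1, membership in \<open>Omega s\<close> says
  \<open>s / 2 * P < - ln p\<close>. This confines the exponent \<open>(s - t) / 2 * P\<close>
  between \<open>ln p\<close> and \<open>(c - 1) * ln p\<close>.\<close>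

lemma f_exp_norm_comparison:
  assumes t: "t > 0" and s: "s \<ge> t / 2" and w: "w \<in> Omega s"
  shows "min 1 (t / s) * (1 - (cmod w)\<^sup>2) \<le> 1 - (cmod (f_exp (s - t) w))\<^sup>2"
    and "1 - (cmod (f_exp (s - t) w))\<^sup>2 \<le> 2 * (1 - (cmod w)\<^sup>2)"
proof -
  let ?v = "f_exp (s - t) w"
  define c where "c = min 1 (t / s)"
  have s0: "s > 0" using t s by linarith
  have c: "0 < c" "c \<le> 1" using t s0 by (auto simp: c_def)
  have "c * (1 - (cmod w)\<^sup>2) \<le> 1 - (cmod ?v)\<^sup>2 \<and> 1 - (cmod ?v)\<^sup>2 \<le> 2 * (1 - (cmod w)\<^sup>2)"
  proof (cases "w = 0")
    case False
    define p where "p = cmod w"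
    have p: "0 < p" "p < 1" using w False by (auto simp: p_def Omega_def)
    define P where "P = (1 - p\<^sup>2) / (cmod (1 - w))\<^sup>2"
    have P: "P \<ge> 0" using p by (simp add: P_def abs_square_le_1)
    have v: "cmod ?v = p * exp ((s - t) / 2 * P)" by (simp add: norm_f_exp P_def p_def)
    have "p * exp (s / 2 * P) < 1" using w by (simp add: Omega_def norm_f_exp P_def p_def)
    then have "ln (p * exp (s / 2 * P)) < 0" using p by (subst ln_less_zero_iff) auto
    then have ln: "ln p + s / 2 * P < 0" using p by (simp add: ln_mult)
    \<comment> \<open>This is where \<open>s \<ge> t / 2\<close> enters, in the form
      \<open>- s \<le> s - t\<close>.\<close>
    have "(- (s / 2)) * P \<le> ((s - t) / 2) * P"
      using s P by (intro mult_right_mono) auto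
    then have "exp (ln p) \<le> exp ((s - t) / 2 * P)" using ln by (subst exp_le_cancel_iff) linarith
    then have "p * p \<le> cmod ?v" using p by (simp add: v)
    then have "(p * p)\<^sup>2 \<le> (cmod ?v)\<^sup>2" using p by (intro power_mono) auto
    \<comment> \<open>The left side is \<open>1 - p ^ 4\<close>; this is the source of the factor
      2.\<close>
    moreover have "(1 - p\<^sup>2) * (1 + p\<^sup>2) \<le> (1 - p\<^sup>2) * 2"
      using p by (intro mult_left_mono) (auto simp: abs_square_le_1)
    ultimately have up: "1 - (cmod ?v)\<^sup>2 \<le> 2 * (1 - p\<^sup>2)" by (simp add: power2_eq_square algebra_simps)
    \<comment> \<open>For \<open>s \<le> t\<close> the exponent is at most 0 and
      \<open>c = 1\<close>. Otherwise the logarithmic constraint is scaled by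
      \<open>(s - t) / s = 1 - c\<close>.\<close>
    have "(s - t) / 2 * P \<le> (c - 1) * ln p"
    proof (cases "s \<le> t")
      case True
      then have "c = 1" using s0 by (simp add: c_def)
      then show ?thesis using True P by (simp add: mult_nonpos_nonneg)
    next
      case False
      then have cs: "c = t / s" using s0 by (simp add: c_def)
      have "((s - t) / s) * (s / 2 * P) \<le> ((s - t) / s) * (- ln p)"
        using ln False s0 by (intro mult_left_mono) auto
      moreover have "((s - t) / s) * (s / 2 * P) = (s - t) / 2 * P" using s0 by simp
      moreover have "((s - t) / s) * (- ln p) = (c - 1) * ln p"
        using s0 by (simp add: cs diff_divide_distrib algebra_simps)
      ultimately show ?thesis by linarith
    qed
    then have "exp ((s - t) / 2 * P) \<le> exp ((c - 1) * ln p)" by simp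
    then have "cmod ?v \<le> p * exp ((c - 1) * ln p)" using p by (simp add: v)
    also have "\<dots> = exp (ln p) * exp ((c - 1) * ln p)" using p by simp
    also have "\<dots> = p powr c"
      using p unfolding exp_add[symmetric] powr_def by (simp add: algebra_simps)
    finally have "(cmod ?v)\<^sup>2 \<le> (p powr c)\<^sup>2" by (intro power_mono) auto
    \<comment> \<open>The factor 1 is inserted so that Young's inequality bounds the power by a
      weighted mean of \<open>p\<^sup>2\<close> and 1.\<close>
    also have "\<dots> = (p\<^sup>2) powr c * 1 powr (1 - c)"
      using p by (simp add: power2_eq_square powr_mult)
    also have "\<dots> \<le> c * p\<^sup>2 + (1 - c) * 1"
      by (rule Youngs_inequality_0) (use c p in auto)
    finally show ?thesis using up by (simp add: p_def algebra_simps)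
  qed (use c in auto)
  then show "min 1 (t / s) * (1 - (cmod w)\<^sup>2) \<le> 1 - (cmod ?v)\<^sup>2"
    and "1 - (cmod ?v)\<^sup>2 \<le> 2 * (1 - (cmod w)\<^sup>2)"
    by (auto simp: c_def)
qed

section \<open>Identification of \<open>chi\<close> and points of \<open>K_st\<close>\<close>

lemma is_nu_right_inverse:
  assumes nu: "is_nu s \<nu>" and z: "z \<in> ball 0 1"
  shows "psi \<nu> z / (1 + psi \<nu> z) \<in> Omega s"
    and "f_exp s (psi \<nu> z / (1 + psi \<nu> z)) = z"
  using assms norm_psi_quotient_less_1(2)[of \<nu> z] by (auto simp: is_nu_def Omega_def)

lemma continuous_on_psi_quotient:
  assumes "prob_on_circle M"
  shows "continuous_on (ball 0 1) (\<lambda>z. psi M z / (1 + psi M z))"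
  by (intro continuous_intros continuous_on_psi assms)
     (use norm_psi_quotient_less_1(1)[OF assms] in auto)

lemma inj_on_f_exp:
  assumes "s > 0" "is_nu s \<nu>"
  shows "inj_on (f_exp s) (closure (Omega s))"
  by (rule inj_on_closure_Omega[OF assms(1) continuous_on_psi_quotient])
     (use assms(2) is_nu_right_inverse in \<open>auto simp: is_nu_def\<close>)

lemma chi_f_exp:
  assumes "s > 0" "is_nu s \<nu>" "w \<in> closure (Omega s)"
  shows "chi s (f_exp s w) = w"
  unfolding chi_def by (rule inv_into_f_f[OF inj_on_f_exp[OF assms(1,2)] assms(3)])

lemma chi_eq_psi_quotient:
  assumes "s > 0" "is_nu s \<nu>" "z \<in> ball 0 1"
  shows "chi s z = psi \<nu> z / (1 + psi \<nu> z)"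
  using chi_f_exp[OF assms(1,2)] is_nu_right_inverse[OF assms(2,3)] closure_subset by (metis subsetD)

text \<open>Injectivity up to the boundary makes each \<open>w\<close> in the closure equal to
  \<open>chi s (f_exp s w)\<close>, with \<open>f_exp s w\<close> in the closed disk. Thus the
  condition on \<zeta> can be applied on all of the compact closure.\<close>

lemma image_closure_Omega_subset_K_st:
  assumes "s > 0" "is_nu s \<nu>"
  shows "f_exp (s - t) ` closure (Omega s) \<subseteq> K_st s t"
proof
  fix v assume "v \<in> f_exp (s - t) ` closure (Omega s)"
  then obtain w where w: "w \<in> closure (Omega s)" "v = f_exp (s - t) w" by auto
  then have "v = chi2 s t (f_exp s w)" by (simp add: chi2_def chi_f_exp[OF assms])
  then show "v \<in> K_st s t"
    using f_exp_closure_Omega[OF assms(1) w(1)] by (auto simp: K_st_def)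
qed

lemma continuous_norm_lower_bound:
  fixes h :: "complex \<Rightarrow> complex"
  assumes "compact S" "continuous_on S h" "\<And>w. w \<in> S \<Longrightarrow> h w \<noteq> 0"
  obtains c where "c > 0" "\<And>w. w \<in> S \<Longrightarrow> c \<le> cmod (h w)"
proof (cases "S = {}")
  case False
  have "continuous_on S (\<lambda>w. cmod (h w))" by (intro continuous_intros assms)
  then obtain x where "x \<in> S" "\<And>w. w \<in> S \<Longrightarrow> cmod (h x) \<le> cmod (h w)"
    using continuous_attains_inf[OF assms(1) False] by blast
  with assms(3)[of x] that[of "cmod (h x)"] show ?thesis by simp
qed (use that[of 1] in auto)

theorem proposition4p9:
  fixes s t :: real and \<zeta> :: complex and \<nu> \<kappa> :: "complex measure"
  assumes "t / 2 > 0" and "s \<ge> t / 2"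
    and "\<zeta> \<in> Sigma_st s t \<inter> sphere 0 1"
    and "is_nu s \<nu>"
    and "is_k s t \<zeta> \<kappa>"
  shows "ac_bounded_density \<nu> \<kappa> \<and> ac_bounded_density \<kappa> \<nu> \<and>
         measure_support \<nu> = measure_support \<kappa>"
proof -
  have t: "t > 0" and s: "s > 0" using assms(1,2) by linarith+
  have \<nu>: "prob_on_circle \<nu>" and \<kappa>: "prob_on_circle \<kappa>"
    using assms(4,5) by (auto simp: is_nu_def is_k_def)
  have fin: "finite_measure \<nu>" "finite_measure \<kappa>"
    and sets: "sets \<nu> = sets circle_borel" "sets \<kappa> = sets circle_borel"
    using \<nu> \<kappa> by (auto simp: prob_on_circle_def prob_space.finite_measure)
  let ?S = "closure (Omega s)"
  have one: "1 \<notin> ?S" by (rule one_notin_closure_Omega[OF s])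
  have \<zeta>: "cmod \<zeta> = 1" "\<zeta> \<in> Sigma_st s t" using assms(3) by auto
  \<comment> \<open>A zero would make \<zeta> the reciprocal of a point of \<open>K_st s t\<close>,
    which \<open>Sigma_st\<close> excludes.\<close>
  have nz: "1 - f_exp (s - t) w * \<zeta> \<noteq> 0" if "w \<in> ?S" for w
  proof
    assume *: "1 - f_exp (s - t) w * \<zeta> = 0"
    then have "f_exp (s - t) w \<noteq> 0" by auto
    moreover from this * have "\<zeta> = 1 / f_exp (s - t) w" by (simp add: field_simps)
    moreover have "f_exp (s - t) w \<in> K_st s t" using image_closure_Omega_subset_K_st[OF s assms(4)] that by blast
    ultimately show False using \<zeta>(2) by (auto simp: Sigma_st_def)
  qed
  obtain a where a: "a > 0" "\<And>w. w \<in> ?S \<Longrightarrow> a \<le> cmod (1 - w)"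
    by (rule continuous_norm_lower_bound[OF compact_closure_Omega, of s "\<lambda>w. 1 - w"])
       (use one in \<open>auto intro!: continuous_intros\<close>)
  obtain b where b: "b > 0" "\<And>w. w \<in> ?S \<Longrightarrow> b \<le> cmod (1 - f_exp (s - t) w * \<zeta>)"
    by (rule continuous_norm_lower_bound[OF compact_closure_Omega, of s "\<lambda>w. 1 - f_exp (s - t) w * \<zeta>"])
       (use one nz in \<open>auto intro!: continuous_intros continuous_on_f_exp\<close>)
  define c where "c = min 1 (t / s)"
  have c: "c > 0" using t s by (simp add: c_def)
  \<comment> \<open>In \<open>8 / b\<^sup>2\<close> the 8 is the 2 of the numerator comparison times
    the bound 4 for \<open>(cmod (1 - w))\<^sup>2\<close>; in \<open>4 / (c * a\<^sup>2)\<close> the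
    4 bounds \<open>(cmod (1 - v))\<^sup>2\<close> and \<open>c\<close> comes from the reverse
    comparison.\<close>
  have bounds: "poisson \<kappa> z \<le> 8 / b\<^sup>2 * poisson \<nu> z" "poisson \<nu> z \<le> 4 / (c * a\<^sup>2) * poisson \<kappa> z"
    if z: "cmod z < 1" for z
  proof -
    have zb: "z \<in> ball 0 1" using z by simp
    define w where "w = psi \<nu> z / (1 + psi \<nu> z)"
    define v where "v = f_exp (s - t) w * \<zeta>"
    have w: "w \<in> Omega s" "w \<in> ?S"
      using is_nu_right_inverse(1)[OF assms(4) zb] closure_subset by (auto simp: w_def)
    have "psi \<kappa> z = (LINT \<omega>|\<kappa>. z * \<omega> / (1 - z * \<omega>))"
      by (simp only: psi_def mult.commute[of _ z])
    also have "\<dots> = chi2 s t z * \<zeta> / (1 - chi2 s t z * \<zeta>)"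
      using assms(5) zb unfolding is_k_def by blast
    also have "chi2 s t z * \<zeta> = v"
      by (simp add: chi2_def v_def w_def chi_eq_psi_quotient[OF s assms(4) zb])
    finally have "psi \<kappa> z = v / (1 - v)" .
    then have P\<kappa>: "poisson \<kappa> z = (1 - (cmod v)\<^sup>2) / (cmod (1 - v))\<^sup>2"
      using nz[OF w(2)] by (intro poisson_eq_of_psi_eq[OF \<kappa> z]) (auto simp: v_def)
    \<comment> \<open>This inverts the quotient that defines \<open>w\<close>.\<close>
    have "psi \<nu> z = w / (1 - w)" "w \<noteq> 1"
      using norm_psi_quotient_less_1(1)[OF \<nu> z] by (auto simp: w_def field_simps)
    then have P\<nu>: "poisson \<nu> z = (1 - (cmod w)\<^sup>2) / (cmod (1 - w))\<^sup>2"
      by (rule poisson_eq_of_psi_eq[OF \<nu> z])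
    define x where "x = 1 - (cmod w)\<^sup>2"
    define y where "y = 1 - (cmod v)\<^sup>2"
    have "cmod v = cmod (f_exp (s - t) w)" using \<zeta> by (simp add: v_def norm_mult)
    then have xy: "c * x \<le> y" "y \<le> 2 * x"
      using f_exp_norm_comparison[OF t assms(2) w(1)] by (simp_all add: x_def y_def c_def)
    have x: "x > 0" using w(1) by (simp add: x_def Omega_def abs_square_less_1)
    then have y: "y > 0" using xy(1) c by (smt (verit) mult_pos_pos)
    then have "cmod v < 1" by (simp add: y_def abs_square_less_1)
    moreover have "cmod w < 1" using w(1) by (simp add: Omega_def)
    ultimately have up: "cmod (1 - w) \<le> 2" "cmod (1 - v) \<le> 2"
      using norm_triangle_ineq4[of 1 w] norm_triangle_ineq4[of 1 v] by auto
    have lo: "a \<le> cmod (1 - w)" "b \<le> cmod (1 - v)" using a(2) b(2) w(2) by (auto simp: v_def)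
    have sq: "(cmod (1 - w))\<^sup>2 \<le> 2\<^sup>2" "(cmod (1 - v))\<^sup>2 \<le> 2\<^sup>2"
      "a\<^sup>2 \<le> (cmod (1 - w))\<^sup>2" "b\<^sup>2 \<le> (cmod (1 - v))\<^sup>2"
      using up lo a(1) b(1) by (auto intro: power_mono simp del: power_numeral)
    have pos: "0 < (cmod (1 - w))\<^sup>2" "0 < (cmod (1 - v))\<^sup>2"
      using lo a(1) b(1) by auto
    have "poisson \<kappa> z \<le> (2 * x) / b\<^sup>2"
      unfolding P\<kappa> y_def[symmetric] using xy sq(4) b(1) x by (intro frac_le) auto
    also have "\<dots> = 8 / b\<^sup>2 * (x / 2\<^sup>2)" by simp
    also have "\<dots> \<le> 8 / b\<^sup>2 * poisson \<nu> z"
      unfolding P\<nu> x_def[symmetric] using sq(1) x pos(1) by (intro mult_left_mono frac_le) auto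
    finally show "poisson \<kappa> z \<le> 8 / b\<^sup>2 * poisson \<nu> z" .
    have "poisson \<nu> z \<le> (y / c) / a\<^sup>2"
      unfolding P\<nu> x_def[symmetric] using xy sq(3) a(1) x y c
      by (intro frac_le) (auto simp: field_simps)
    also have "\<dots> = 4 / (c * a\<^sup>2) * (y / 2\<^sup>2)" by simp
    also have "\<dots> \<le> 4 / (c * a\<^sup>2) * poisson \<kappa> z"
      unfolding P\<kappa> y_def[symmetric] using sq(2) y pos(2) c by (intro mult_left_mono frac_le) auto
    finally show "poisson \<nu> z \<le> 4 / (c * a\<^sup>2) * poisson \<kappa> z" .
  qed
  have "ac_bounded_density \<nu> \<kappa>"
    using fin sets bounds(1) by (intro ac_bounded_densityI[where C = "8 / b\<^sup>2"] emeasure_le_of_poisson_le) auto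
  moreover have "ac_bounded_density \<kappa> \<nu>"
    using fin sets bounds(2) c
    by (intro ac_bounded_densityI[where C = "4 / (c * a\<^sup>2)"] emeasure_le_of_poisson_le) auto
  ultimately show ?thesis
    using measure_support_mono sets unfolding ac_bounded_density_def by blast
qed

end
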